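(* Let $\mathbf A$ be a real $n\times n$ SK-matrix. Then $\mathbf A$ has $n$ positive simple eigenvalues $$\rho(\mathbf A)=\lambda_1>\lambda_2>\cdots>\lambda_n>0 .$$ Moreover, for each $r\in\{1,n\}$, if $\mu_1^{(r)}>\mu_2^{(r)}>\cdots>\mu_{n-1}^{(r)}>0$ are the eigenvalues of the principal submatrix of $\mathbf A$ obtained by deleting the $r$th row and the $r$th column, then $$\lambda_j>\mu_j^{(r)}>\lambda_{j+1},\qquad j=1,\ldots,n-1 .$$
   Context: Let $[n]=\{1,\ldots,n\}$. A principal minor of an $n\times n$ matrix $\mathbf A$ is the determinant of a submatrix whose rows and columns are both indexed by the same nonempty subset of $[n]$. An almost principal minor of $\mathbf A$ is a minor whose row set is $\{i_1,\ldots,i_k\}\setminus\{i_r\}$ and whose column set is $\{i_1,\ldots,i_k\}\setminus\{i_s\}$, where $\{i_1<\cdots<i_k\}\subseteq[n]$, $k\ge2$, $1\le r,s\le k$ and $r\ne s$ (rows and columns are listed in increasing order). A real square matrix is an SK-matrix (strictly Kotelyansky matrix) if all its principal minors and all its almost principal minors are positive. Principal submatrices of SK-matrices are again SK-matrices. $\rho(\mathbf A)$ denotes the spectral radius. *)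

theory Defs
  imports
    "Jordan_Normal_Form.DL_Submatrix"
    "Jordan_Normal_Form.Determinant"
    "Jordan_Normal_Form.Char_Poly"
    "Jordan_Normal_Form.Spectral_Radius"
begin

text \<open>Rows and columns of a matrix are numbered from \<open>0\<close>, so \<open>[n]\<close> is rendered by \<open>{0..<n}\<close>.
  The operation \<open>submatrix A I J\<close> lists the rows in \<open>I\<close> and the columns in \<open>J\<close> in increasing order.\<close>

definition SK_matrix :: "real mat \<Rightarrow> bool" where
  "SK_matrix A \<longleftrightarrow> square_mat A \<and>
     (\<forall>I \<subseteq> {0..<dim_row A}. I \<noteq> {} \<longrightarrow> det (submatrix A I I) > 0) \<and>
     (\<forall>I \<subseteq> {0..<dim_row A}. \<forall>p\<in>I. \<forall>q\<in>I. p \<noteq> q \<longrightarrow> det (submatrix A (I - {p}) (I - {q})) > 0)"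

text \<open>The following says that \<open>e 1 > e 2 > \<dots> > e m > 0\<close> and that these are all the eigenvalues
  of \<open>A\<close>; non-real eigenvalues are excluded because the spectrum is taken over the complex numbers.
  The values of \<open>e\<close> outside \<open>{1..m}\<close> are irrelevant. For \<open>m = 0\<close> the list is empty.\<close>

definition decreasing_positive_eigenvalues :: "real mat \<Rightarrow> nat \<Rightarrow> (nat \<Rightarrow> real) \<Rightarrow> bool" where
  "decreasing_positive_eigenvalues A m e \<longleftrightarrow>
     (\<forall>j. 1 \<le> j \<and> j < m \<longrightarrow> e j > e (j + 1)) \<and>
     (\<forall>j\<in>{1..m}. e j > 0) \<and>
     spectrum (map_mat complex_of_real A) = (\<lambda>j. complex_of_real (e j)) ` {1..m}"

end

theory Submission
  imports Defs
begin

text \<open>Let \<open>f(t) = det (t I - A)\<close>, let \<open>p\<close> and \<open>q\<close> be the characteristic polynomials obtained by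
  deleting the first and the last index, and \<open>h\<close> the one obtained by deleting both. The
  Desnanot--Jacobi identity reads \<open>f h = p q - c c'\<close>, where \<open>c\<close> and \<open>c'\<close> are the two corner minors of
  \<open>t I - A\<close>. Up to a common sign, the coefficients of \<open>c\<close> and \<open>c'\<close> are sums of almost principal minors of
  \<open>A\<close>, so \<open>c c' > 0\<close> for \<open>t \<ge> 0\<close>. Hence \<open>f\<close> and \<open>h\<close> have opposite signs at the roots of \<open>p\<close> and of
  \<open>q\<close>. By induction the roots of \<open>h\<close> interlace those of \<open>p\<close>, so \<open>f\<close> alternates in sign along \<open>0\<close>, the
  roots of \<open>p\<close> and \<open>\<infinity>\<close>, and the intermediate value theorem yields all \<open>n\<close> roots of \<open>f\<close>.\<close>

section \<open>Submatrices and deletion of rows and columns\<close>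

lemma pick_image:
  assumes f: "strict_mono f" and k: "k < card S \<or> infinite S"
  shows "pick (f ` S) k = f (pick S k)"
proof -
  have "{a \<in> f ` S. a < f (pick S k)} = f ` {a \<in> S. a < pick S k}"
    using strict_mono_less[OF f] by auto
  moreover have "inj_on f {a \<in> S. a < pick S k}"
    using f by (meson inj_on_subset strict_mono_imp_inj_on subset_UNIV)
  ultimately have "card {a \<in> f ` S. a < f (pick S k)} = k"
    using card_pick[OF k] by (simp add: card_image)
  then show ?thesis
    using pick_card_in_set[of "f (pick S k)" "f ` S"] pick_in_set[OF k] by simp
qed

lemma pick_atLeastLessThan:
  assumes "k < m" shows "pick {0..<m} k = k"
proof -
  have "pick UNIV k = pick {a. a < m \<and> a \<in> UNIV} k"
    by (rule pick_reduce_set) (use assms in simp)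
  moreover have "{a. a < m \<and> a \<in> UNIV} = {0..<m}" by auto
  ultimately show ?thesis by (simp add: pick_UNIV)
qed

lemma strict_mono_insert_index: "strict_mono (insert_index i)"
  unfolding strict_mono_def insert_index_def by auto

text \<open>\<open>insert_index\<close> is strictly monotone and so commutes with
  \<open>pick\<close>: index sets are translated without reordering.\<close>

lemma submatrix_mat_delete:
  assumes A: "A \<in> carrier_mat (Suc m) (Suc m)" and i: "i \<le> m" and j: "j \<le> m"
    and I: "I \<subseteq> {0..<m}" and J: "J \<subseteq> {0..<m}"
  shows "submatrix (mat_delete A i j) I J = submatrix A (insert_index i ` I) (insert_index j ` J)"
proof -
  have inj: "inj_on (insert_index a) X" for a X by (rule insert_index_inj_on)
  have 1: "{x. x < m \<and> x \<in> I} = I" "{x. x < m \<and> x \<in> J} = J" using I J by auto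
  have 2: "{x. x < Suc m \<and> x \<in> insert_index i ` I} = insert_index i ` I"
    "{x. x < Suc m \<and> x \<in> insert_index j ` J} = insert_index j ` J"
    using I J by (auto simp: insert_index_def)
  have dims: "dim_row A = Suc m" "dim_col A = Suc m" using A by auto
  show ?thesis
  proof (rule eq_matI, goal_cases)
    case (1 a b)
    then have a: "a < card I" and b: "b < card J"
      by (simp_all add: dim_submatrix dims 2 card_image[OF inj])
    have pa: "pick I a < m" and pb: "pick J b < m"
      using pick_in_set_le[OF a] pick_in_set_le[OF b] I J by auto
    have "submatrix (mat_delete A i j) I J $$ (a, b) = mat_delete A i j $$ (pick I a, pick J b)"
      by (rule submatrix_index) (simp_all add: dims \<open>{x. x < m \<and> x \<in> I} = I\<close> \<open>{x. x < m \<and> x \<in> J} = J\<close> a b)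
    also have "\<dots> = A $$ (insert_index i (pick I a), insert_index j (pick J b))"
      by (rule mat_delete_index[symmetric, OF A]) (use i j pa pb in auto)
    also have "\<dots> = A $$ (pick (insert_index i ` I) a, pick (insert_index j ` J) b)"
      using a b by (simp add: pick_image[OF strict_mono_insert_index])
    also have "\<dots> = submatrix A (insert_index i ` I) (insert_index j ` J) $$ (a, b)"
      by (rule submatrix_index[symmetric]) (simp_all add: dims 2 card_image[OF inj] a b)
    finally show ?case .
  qed (simp_all add: dim_submatrix dims 1 2 card_image[OF inj])
qed

lemma submatrix_atLeastLessThan:
  assumes "A \<in> carrier_mat n n"
  shows "submatrix A {0..<n} {0..<n} = A"
proof -
  have "{x. x < n \<and> x \<in> {0..<n}} = {0..<n}" by auto
  then show ?thesis
    using assms by (intro eq_matI) (auto simp: dim_submatrix submatrix_index pick_atLeastLessThan)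
qed

lemma mat_delete_eq_submatrix:
  assumes A: "A \<in> carrier_mat n n" and i: "i < n" and j: "j < n"
  shows "mat_delete A i j = submatrix A ({0..<n} - {i}) ({0..<n} - {j})"
proof -
  obtain m where n: "n = Suc m" using i by (cases n) auto
  have "mat_delete A i j = submatrix (mat_delete A i j) {0..<m} {0..<m}"
    by (rule submatrix_atLeastLessThan[symmetric]) (use mat_delete_carrier[OF A] n in auto)
  also have "\<dots> = submatrix A (insert_index i ` {0..<m}) (insert_index j ` {0..<m})"
    by (rule submatrix_mat_delete) (use A i j n in auto)
  also have "\<dots> = submatrix A ({0..<n} - {i}) ({0..<n} - {j})"
    using i j unfolding n by (simp add: insert_index_image)
  finally show ?thesis .
qed

lemma submatrix_transpose:
  "submatrix (transpose_mat A) I J = transpose_mat (submatrix A J I)"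
proof (rule eq_matI, goal_cases)
  case (1 i j)
  then have ij: "i < card {i. i < dim_col A \<and> i \<in> I}" "j < card {i. i < dim_row A \<and> i \<in> J}"
    by (simp_all add: dim_submatrix)
  have "pick I i < dim_col A" "pick J j < dim_row A"
    using ij by (auto intro: pick_le)
  then show ?case using ij by (simp add: submatrix_index dim_submatrix)
qed (simp_all add: dim_submatrix)

section \<open>Closure properties of SK-matrices\<close>

text \<open>\<open>insert_index i\<close> is injective and so respects the removal of a single
  element; every principal or almost principal minor of the smaller matrix is a minor of the same
  kind of \<open>A\<close>.\<close>

lemma SK_matrix_delete:
  assumes SK: "SK_matrix A" and A: "A \<in> carrier_mat n n" and i: "i < n"
  shows "SK_matrix (mat_delete A i i)"
proof -
  obtain m where n: "n = Suc m" using i by (cases n) auto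
  let ?h = "insert_index i"
  have sub: "submatrix (mat_delete A i i) I J = submatrix A (?h ` I) (?h ` J)"
    if "I \<subseteq> {0..<m}" "J \<subseteq> {0..<m}" for I J
    by (rule submatrix_mat_delete) (use A i n that in auto)
  have h: "?h ` I \<subseteq> {0..<n}" if "I \<subseteq> {0..<m}" for I
    using that n by (auto simp: insert_index_def)
  have inj: "inj ?h" by (rule insert_index_inj_on)
  have hd: "?h ` (I - {p}) = ?h ` I - {?h p}" for I p
    by (simp add: image_set_diff[OF inj])
  have hne: "?h p \<noteq> ?h q" if "p \<noteq> q" for p q
    using that by (simp add: inj_eq[OF inj])
  have pm: "det (submatrix A I I) > 0" if "I \<subseteq> {0..<n}" "I \<noteq> {}" for I
    using SK A that unfolding SK_matrix_def by auto
  have apm: "det (submatrix A (I - {p}) (I - {q})) > 0"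
    if "I \<subseteq> {0..<n}" "p \<in> I" "q \<in> I" "p \<noteq> q" for I p q
    using SK A that unfolding SK_matrix_def by auto
  have dims: "dim_row (mat_delete A i i) = m" "dim_col (mat_delete A i i) = m"
    using A n by auto
  show ?thesis
    unfolding SK_matrix_def dims
  proof (intro conjI allI impI ballI)
    show "square_mat (mat_delete A i i)" using dims by simp
  next
    fix I assume I: "I \<subseteq> {0..<m}" "I \<noteq> {}"
    then show "det (submatrix (mat_delete A i i) I I) > 0"
      using pm[OF h[OF I(1)]] by (simp add: sub)
  next
    fix I p q assume I: "I \<subseteq> {0..<m}" and pq: "p \<in> I" "q \<in> I" "p \<noteq> q"
    have "I - {p} \<subseteq> {0..<m}" "I - {q} \<subseteq> {0..<m}" using I by auto
    then show "det (submatrix (mat_delete A i i) (I - {p}) (I - {q})) > 0"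
      using apm[OF h[OF I], of "?h p" "?h q"] pq hne by (simp add: sub hd)
  qed
qed

text \<open>Transposition exchanges the roles of \<open>p\<close> and \<open>q\<close> in an almost
  principal minor. It later reduces one corner minor to the other.\<close>

lemma SK_matrix_transpose:
  assumes "SK_matrix A"
  shows "SK_matrix (transpose_mat A)"
proof -
  have sq: "dim_col A = dim_row A" using assms by (simp add: SK_matrix_def)
  have "det (transpose_mat (submatrix A I J)) = det (submatrix A I J)"
    if "card I = card J" "I \<subseteq> {0..<dim_row A}" "J \<subseteq> {0..<dim_row A}" for I J
  proof (rule det_transpose)
    have "{i. i < dim_row A \<and> i \<in> I} = I" "{i. i < dim_row A \<and> i \<in> J} = J" using that by auto
    then show "submatrix A I J \<in> carrier_mat (card I) (card I)"
      using that sq by (auto simp: dim_submatrix)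
  qed
  moreover have "finite I" if "I \<subseteq> {0..<dim_row A}" for I using that finite_subset by blast
  ultimately show ?thesis using assms
    unfolding SK_matrix_def
    by (auto simp: submatrix_transpose card_Diff_singleton_if subset_iff)
qed

section \<open>Positivity of the corner minors of \<open>A - t I\<close>\<close>

text \<open>Subtracting \<open>t\<close> one diagonal entry at a time lets the positivity of a corner minor be proved
  by induction instead of by expanding it into its coefficients in \<open>t\<close>.\<close>

definition shift_diag :: "real mat \<Rightarrow> real \<Rightarrow> nat \<Rightarrow> real mat" where
  "shift_diag A t k = mat (dim_row A) (dim_col A)
     (\<lambda>(i, j). A $$ (i, j) - (if i = j \<and> i < k then t else 0))"

lemma shift_diag_carrier [simp]:
  "A \<in> carrier_mat n n \<Longrightarrow> shift_diag A t k \<in> carrier_mat n n"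
  by (auto simp: shift_diag_def)

text \<open>Passing from \<open>k\<close> to \<open>Suc k\<close> changes at most one entry of the
  corner submatrix. If one changes, the determinant grows by \<open>t\<close> times the same corner
  minor for \<open>A\<close> without row and column \<open>k\<close>, so the induction must vary
  \<open>A\<close> and \<open>n\<close>.\<close>

lemma det_delete_corner_shift_diag_pos:
  assumes "SK_matrix A" "A \<in> carrier_mat n n" "2 \<le> n" "0 \<le> t"
  shows "det (mat_delete (shift_diag A t k) (n - 1) 0) > 0"
  using assms
proof (induction k arbitrary: A n)
  case 0
  have "shift_diag A t 0 = A"
    by (rule eq_matI) (auto simp: shift_diag_def)
  moreover have "det (mat_delete A (n - 1) 0) > 0"
    using 0 by (subst mat_delete_eq_submatrix[OF \<open>A \<in> carrier_mat n n\<close>]) (auto simp: SK_matrix_def)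
  ultimately show ?case by simp
next
  case (Suc k)
  note A = \<open>A \<in> carrier_mat n n\<close>
  define N where "N = mat_delete (shift_diag A t (Suc k)) (n - 1) 0"
  define N0 where "N0 = mat_delete (shift_diag A t k) (n - 1) 0"
  have N: "N \<in> carrier_mat (n - 1) (n - 1)" and N0: "N0 \<in> carrier_mat (n - 1) (n - 1)"
    unfolding N_def N0_def by (rule mat_delete_carrier[OF shift_diag_carrier[OF A]])+
  have idx: "N $$ (i, j) = A $$ (i, Suc j) - (if i = Suc j \<and> i < Suc k then t else 0)"
    "N0 $$ (i, j) = A $$ (i, Suc j) - (if i = Suc j \<and> i < k then t else 0)"
    if "i < n - 1" "j < n - 1" for i j
    using that A by (auto simp: N_def N0_def mat_delete_def shift_diag_def)
  have pos0: "det N0 > 0" using Suc.IH[OF Suc.prems] by (simp add: N0_def)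
  show ?case
  proof (cases "0 < k \<and> k < n - 1")
    \<comment> \<open>The diagonal entry \<open>(k, k)\<close> lies in the deleted column
      (\<open>k = 0\<close>), in the deleted row (\<open>k = n - 1\<close>) or outside the
      matrix.\<close>
    case False
    have "N = N0"
      by (rule eq_matI) (use N N0 False in \<open>auto simp: idx\<close>)
    then show ?thesis using pos0 by (simp add: N_def)
  next
    case True
    define A' where "A' = mat_delete A k k"
    have A': "A' \<in> carrier_mat (n - 1) (n - 1)" and SK': "SK_matrix A'"
      using SK_matrix_delete[OF Suc.prems(1) A, of k] mat_delete_carrier[OF A, of k k] True
      by (simp_all add: A'_def less_diff_conv)
    have pos': "det (mat_delete (shift_diag A' t k) (n - 1 - 1) 0) > 0"
      by (rule Suc.IH[OF SK' A']) (use True Suc.prems in auto)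
    \<comment> \<open>Column \<open>j\<close> of \<open>N\<close> is column \<open>j + 1\<close> of
      \<open>A\<close>, so removing row \<open>k\<close> and column \<open>k - 1\<close> from
      \<open>N\<close> removes index \<open>k\<close> from \<open>A\<close>. Diagonal entries beyond
      \<open>k\<close> are not yet shifted, hence the parameter \<open>k\<close> for
      \<open>A'\<close>.\<close>
    have minor: "mat_delete N k (k - 1) = mat_delete (shift_diag A' t k) (n - 1 - 1) 0"
    proof (rule eq_matI, goal_cases)
      case (1 i j)
      then have ij: "i < n - 1 - 1" "j < n - 1 - 1" using A' by (auto simp: shift_diag_def)
      then have "mat_delete N k (k - 1) $$ (i, j) = N $$ (insert_index k i, insert_index (k - 1) j)"
        using N by (auto simp: mat_delete_def insert_index_def)
      also have "\<dots> = A $$ (insert_index k i, insert_index k (Suc j)) -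
          (if i = Suc j \<and> i < k then t else 0)"
        using ij True by (subst idx) (auto simp: insert_index_def)
      also have "\<dots> = A' $$ (i, Suc j) - (if i = Suc j \<and> i < k then t else 0)"
        using ij A by (auto simp: A'_def mat_delete_def insert_index_def)
      also have "\<dots> = mat_delete (shift_diag A' t k) (n - 1 - 1) 0 $$ (i, j)"
        using ij A' by (auto simp: mat_delete_def shift_diag_def)
      finally show ?case .
    qed (use N A' in \<open>auto simp: shift_diag_def\<close>)
    \<comment> \<open>\<open>N\<close> and \<open>N0\<close> differ only in row
      \<open>k\<close>.\<close>
    have cof: "cofactor N k j = cofactor N0 k j" if "j < n - 1" for j
    proof -
      have "mat_delete N k j = mat_delete N0 k j"
        by (rule eq_matI) (use N N0 that in \<open>auto simp: mat_delete_def idx\<close>)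
      then show ?thesis by (simp add: cofactor_def)
    qed
    have "det N = (\<Sum>j<n-1. N $$ (k, j) * cofactor N k j)"
      using laplace_expansion_row[OF N] True by simp
    also have "\<dots> = (\<Sum>j<n-1. N0 $$ (k, j) * cofactor N0 k j - (if j = k - 1 then t * cofactor N k j else 0))"
      using True by (intro sum.cong) (auto simp: idx cof algebra_simps)
    also have "\<dots> = (\<Sum>j<n-1. N0 $$ (k, j) * cofactor N0 k j) - t * cofactor N k (k - 1)"
    proof -
      have "k - 1 \<in> {..<n-1}" using True by auto
      then show ?thesis by (simp only: sum_subtractf sum.delta finite_lessThan if_True)
    qed
    also have "\<dots> = det N0 - t * cofactor N k (k - 1)"
      using laplace_expansion_row[OF N0, of k] True by simp
    \<comment> \<open>The altered entry sits just below the diagonal of \<open>N\<close>; the minus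
      sign of its cofactor turns the subtracted \<open>t\<close> into a nonnegative
      contribution.\<close>
    also have "cofactor N k (k - 1) = - det (mat_delete N k (k - 1))"
    proof -
      have "odd (k + (k - 1))" using True by presburger
      then show ?thesis unfolding cofactor_def power_minus_odd[OF \<open>odd _\<close>] by simp
    qed
    finally have "det N = det N0 + t * det (mat_delete N k (k - 1))" by simp
    moreover have "t * det (mat_delete N k (k - 1)) \<ge> 0"
      using pos' Suc.prems unfolding minor by simp
    ultimately show ?thesis using pos0 by (simp add: N_def)
  qed
qed


section \<open>The Desnanot-Jacobi identity\<close>

lemma det_replace_col_unit_vec:
  assumes A: "A \<in> carrier_mat n n" and k: "k < n"
  shows "det (replace_col A (s \<cdot>\<^sub>v unit_vec n k) k) = s * det (mat_delete A k k)"
proof -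
  let ?R = "replace_col A (s \<cdot>\<^sub>v unit_vec n k) k"
  have R: "?R \<in> carrier_mat n n" using A by (auto simp: replace_col_def)
  have "det ?R = (\<Sum>i<n. ?R $$ (i, k) * cofactor ?R i k)"
    by (rule laplace_expansion_column[OF R k])
  also have "\<dots> = (\<Sum>i<n. if i = k then s * cofactor ?R k k else 0)"
    using A k by (intro sum.cong) (auto simp: replace_col_def)
  also have "\<dots> = s * cofactor ?R k k" using k by simp
  also have "mat_delete ?R k k = mat_delete A k k"
    using A k by (intro eq_matI) (auto simp: mat_delete_def replace_col_def)
  then have "cofactor ?R k k = det (mat_delete A k k)"
    by (simp add: cofactor_def flip: mult_2)
  finally show ?thesis .
qed

text \<open>Replacing column \<open>0\<close> of \<open>M\<close> by a unit vector gives a matrix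
  with determinant \<open>det (mat_delete M 0 0)\<close>; Cramer's rule is applied to it, and the required
  solution vector is a combination of the first and last columns of the adjugate of \<open>M\<close>.\<close>

lemma desnanot_jacobi:
  fixes M :: "'a :: idom mat"
  assumes M: "M \<in> carrier_mat (Suc l) (Suc l)" and l: "0 < l"
    and nz: "det (mat_delete M 0 0) \<noteq> 0"
  shows "det M * det (mat_delete (mat_delete M l l) 0 0) =
    det (mat_delete M 0 0) * det (mat_delete M l l) - det (mat_delete M 0 l) * det (mat_delete M l 0)"
proof -
  let ?n = "Suc l" and ?d = "det M"
  define a where "a = det (mat_delete M 0 0)"
  \<comment> \<open>Writing \<open>e_i\<close> for unit vectors, these columns of the adjugate
    satisfy \<open>M u = ?d e_0\<close> and \<open>M v = ?d e_l\<close>.\<close>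
  define u where "u i = adj_mat M $$ (i, 0)" for i
  define v where "v i = adj_mat M $$ (i, l)" for i
  have adj: "adj_mat M \<in> carrier_mat ?n ?n" by (rule adj_mat[OF M])
  have prod: "(\<Sum>j<?n. M $$ (i, j) * adj_mat M $$ (j, k)) = (if i = k then ?d else 0)"
    if "i < ?n" "k < ?n" for i k
  proof -
    have "(M * adj_mat M) $$ (i, k) = (\<Sum>j<?n. M $$ (i, j) * adj_mat M $$ (j, k))"
      using M adj that by (auto simp: scalar_prod_def lessThan_atLeast0 intro!: sum.cong)
    then show ?thesis using that by (cases "i = k") (simp_all add: adj_mat(2)[OF M] del: sum.lessThan_Suc)
  qed
  define M1 where "M1 = replace_col M (1 \<cdot>\<^sub>v unit_vec ?n 0) 0"
  have M1: "M1 \<in> carrier_mat ?n ?n" using M by (auto simp: M1_def replace_col_def)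
  have det_M1: "det M1 = a"
    unfolding M1_def a_def by (subst det_replace_col_unit_vec[OF M]) auto
  \<comment> \<open>The vector \<open>u 0 * v - v 0 * u\<close> vanishes at index \<open>0\<close>,
    so replacing column \<open>0\<close> does not affect its image
    \<open>?d * (u 0 * e_l - v 0 * e_0)\<close>. The extra term at index \<open>0\<close> cancels
    the \<open>e_0\<close> part, since column \<open>0\<close> of \<open>M1\<close> is
    \<open>e_0\<close>.\<close>
  define x where "x = vec ?n (\<lambda>j. (u 0 * v j - v 0 * u j) + (if j = 0 then ?d * v 0 else 0))"
  have x: "x \<in> carrier_vec ?n" by (simp add: x_def)
  have "M1 *\<^sub>v x = (u 0 * ?d) \<cdot>\<^sub>v unit_vec ?n l"
  proof (rule eq_vecI, goal_cases)
    case (1 i)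
    then have i: "i < ?n" by simp
    have "(M1 *\<^sub>v x) $ i = (\<Sum>j<?n. M1 $$ (i, j) * x $ j)"
      using M1 x i by (auto simp: scalar_prod_def lessThan_atLeast0 intro!: sum.cong)
    also have "\<dots> = (\<Sum>j<?n. M $$ (i, j) * (u 0 * v j - v 0 * u j)
        + (if j = 0 then (if i = 0 then ?d * v 0 else 0) else 0))"
      using M i by (intro sum.cong) (auto simp: M1_def replace_col_def x_def)
    also have "\<dots> = (\<Sum>j<?n. M $$ (i, j) * (u 0 * v j - v 0 * u j))
        + (if i = 0 then ?d * v 0 else 0)"
      by (simp add: sum.distrib del: sum.lessThan_Suc)
    also have "\<dots> = (\<Sum>j<?n. u 0 * (M $$ (i, j) * v j) - v 0 * (M $$ (i, j) * u j))
        + (if i = 0 then ?d * v 0 else 0)"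
      by (simp only: right_diff_distrib mult.left_commute)
    also have "\<dots> = u 0 * (\<Sum>j<?n. M $$ (i, j) * v j) - v 0 * (\<Sum>j<?n. M $$ (i, j) * u j)
        + (if i = 0 then ?d * v 0 else 0)"
      by (simp only: sum_subtractf sum_distrib_left)
    also have "\<dots> = u 0 * (if i = l then ?d else 0)"
      using prod[of i l] prod[of i 0] i unfolding u_def v_def by simp
    also have "\<dots> = ((u 0 * ?d) \<cdot>\<^sub>v unit_vec ?n l) $ i"
      using i by simp
    finally show ?case .
  qed (use M1 in auto)
  then have "det (replace_col M1 ((u 0 * ?d) \<cdot>\<^sub>v unit_vec ?n l) l) = x $ l * a"
    using cramer_lemma_mat[OF M1 x, of l] det_M1 by simp
  then have cramer: "u 0 * ?d * det (mat_delete M1 l l) = (u 0 * v l - v 0 * u l) * a"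
    using l by (simp add: det_replace_col_unit_vec[OF M1] x_def)
  have del: "mat_delete M l l \<in> carrier_mat l l" using mat_delete_carrier[OF M] by simp
  have "mat_delete M1 l l = replace_col (mat_delete M l l) (1 \<cdot>\<^sub>v unit_vec l 0) 0"
    using M l by (intro eq_matI) (auto simp: M1_def mat_delete_def replace_col_def)
  then have interior: "det (mat_delete M1 l l) = det (mat_delete (mat_delete M l l) 0 0)"
    using det_replace_col_unit_vec[OF del l, of 1] by simp
  have "u 0 = a" "v l = det (mat_delete M l l)"
    "v 0 = (-1)^l * det (mat_delete M l 0)" "u l = (-1)^l * det (mat_delete M 0 l)"
    using M by (auto simp: u_def v_def a_def adj_mat_def cofactor_def)
  then have "a * (?d * det (mat_delete (mat_delete M l l) 0 0)) =
    a * (a * det (mat_delete M l l) - ((-1)^l * (-1)^l) * (det (mat_delete M 0 l) * det (mat_delete M l 0)))"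
    using cramer unfolding interior by (simp add: algebra_simps)
  moreover have "(-1)^l * (-1)^l = (1 :: 'a)" by (simp flip: power_mult_distrib)
  \<comment> \<open>Cramer's rule leaves a common factor \<open>a\<close> on both sides, which
    \<open>nz\<close> cancels.\<close>
  ultimately show ?thesis using nz unfolding a_def by simp
qed

section \<open>Characteristic polynomials of SK-matrices\<close>

lemma char_poly_matrix_delete:
  assumes "A \<in> carrier_mat n n" "i < n"
  shows "char_poly_matrix (mat_delete A i i) = mat_delete (char_poly_matrix A) i i"
  using assms by (intro eq_matI) (auto simp: char_poly_matrix_def mat_delete_def)

text \<open>\<open>t I - A\<close> is the negative of \<open>shift_diag A t n\<close>, and a minor
  of size \<open>n - 1\<close> contributes that many signs.\<close>

lemma poly_det_delete_char_poly_matrix: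
  fixes A :: "real mat"
  assumes A: "A \<in> carrier_mat n n"
  shows "poly (det (mat_delete (char_poly_matrix A) i j)) t =
    (-1) ^ (n - 1) * det (mat_delete (shift_diag A t n) i j)"
proof -
  have C: "mat_delete (char_poly_matrix A) i j \<in> carrier_mat (n - 1) (n - 1)"
    and S: "mat_delete (shift_diag A t n) i j \<in> carrier_mat (n - 1) (n - 1)"
    by (rule mat_delete_carrier[OF char_poly_matrix_closed[OF A]],
        rule mat_delete_carrier[OF shift_diag_carrier[OF A]])
  have "poly (det (mat_delete (char_poly_matrix A) i j)) t =
      det (- 1 \<cdot>\<^sub>m mat_delete (shift_diag A t n) i j)"
    by (rule poly_det_cong[OF _ C])
      (use S A in \<open>auto simp: mat_delete_def char_poly_matrix_def shift_diag_def\<close>)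
  then show ?thesis by (simp only: det_smult carrier_matD(2)[OF S])
qed

text \<open>The gap between the two sides is the product of the corner minors. At a root of a factor
  on the right, the factors on the left get opposite signs.\<close>

lemma SK_matrix_char_poly_less:
  assumes SK: "SK_matrix A" and A: "A \<in> carrier_mat (Suc l) (Suc l)" and l: "0 < l" and t: "0 \<le> t"
  shows "poly (char_poly A) t * poly (char_poly (mat_delete (mat_delete A l l) 0 0)) t
    < poly (char_poly (mat_delete A 0 0)) t * poly (char_poly (mat_delete A l l)) t"
proof -
  let ?M = "char_poly_matrix A" and ?n = "Suc l"
  let ?S = "shift_diag A t ?n"
  have M: "?M \<in> carrier_mat ?n ?n" using A by simp
  have D: "mat_delete A l l \<in> carrier_mat l l" "mat_delete A 0 0 \<in> carrier_mat l l"
    using mat_delete_carrier[OF A] by simp_all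
  have cp: "det ?M = char_poly A" "det (mat_delete ?M 0 0) = char_poly (mat_delete A 0 0)"
    "det (mat_delete ?M l l) = char_poly (mat_delete A l l)"
    "det (mat_delete (mat_delete ?M l l) 0 0) = char_poly (mat_delete (mat_delete A l l) 0 0)"
    using l by (simp_all add: char_poly_def char_poly_matrix_delete[OF A] char_poly_matrix_delete[OF D(1)])
  \<comment> \<open>The identity is applied over the polynomial ring, where this minor is nonzero
    because it is monic; its value at a given \<open>t\<close> may vanish.\<close>
  have "det (mat_delete ?M 0 0) \<noteq> 0"
    unfolding cp using degree_monic_char_poly[OF D(2)] by auto
  note desnanot = desnanot_jacobi[OF M l this, unfolded cp]
  have pos: "det (mat_delete ?S l 0) > 0"
    using det_delete_corner_shift_diag_pos[OF SK A _ t, of ?n] l by simp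
  have At: "transpose_mat A \<in> carrier_mat ?n ?n" using A by simp
  \<comment> \<open>The opposite corner minor is a corner minor of the transpose, again an
    SK-matrix.\<close>
  have "mat_delete ?S 0 l = transpose_mat (mat_delete (shift_diag (transpose_mat A) t ?n) l 0)"
    using A by (intro eq_matI) (auto simp: mat_delete_def shift_diag_def)
  then have "det (mat_delete ?S 0 l) = det (mat_delete (shift_diag (transpose_mat A) t ?n) l 0)"
    using det_transpose[of "mat_delete (shift_diag (transpose_mat A) t ?n) l 0" l]
      mat_delete_carrier[OF shift_diag_carrier[OF At]] by simp
  then have pos': "det (mat_delete ?S 0 l) > 0"
    using det_delete_corner_shift_diag_pos[OF SK_matrix_transpose[OF SK] At _ t, of ?n] l by simp
  have "poly (det (mat_delete ?M 0 l) * det (mat_delete ?M l 0)) t =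
      ((-1)^l * (-1)^l) * (det (mat_delete ?S 0 l) * det (mat_delete ?S l 0))"
    by (simp add: poly_det_delete_char_poly_matrix[OF A])
  also have "(-1)^l * (-1)^l = (1 :: real)" by (simp flip: power_mult_distrib)
  finally have "poly (det (mat_delete ?M 0 l) * det (mat_delete ?M l 0)) t > 0"
    using pos pos' by simp
  then show ?thesis
    using arg_cong[OF desnanot, of "\<lambda>p. poly p t"] by simp
qed

lemma SK_matrix_char_poly_0:
  assumes SK: "SK_matrix A" and A: "A \<in> carrier_mat n n" and n: "0 < n"
  shows "(-1) ^ n * poly (char_poly A) 0 > 0"
proof -
  have "det A > 0"
    using SK A n submatrix_atLeastLessThan[OF A] unfolding SK_matrix_def
    by (metis atLeastLessThan_empty_iff carrier_matD(1) order_refl)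
  moreover have "poly (char_poly A) 0 = det (- 1 \<cdot>\<^sub>m A)"
    unfolding char_poly_def
    by (rule poly_det_cong[of _ n]) (use A in \<open>auto simp: char_poly_matrix_def\<close>)
  moreover have "(-1) ^ n * (-1) ^ n = (1 :: real)" by (simp flip: power_mult_distrib)
  ultimately show ?thesis using A by (simp flip: mult.assoc)
qed

section \<open>Decreasing lists of roots and interlacing\<close>

text \<open>A full factorisation rather than a set of roots records simplicity and also rules out
  further complex roots.\<close>

definition decreasing_positive_roots :: "real poly \<Rightarrow> nat \<Rightarrow> (nat \<Rightarrow> real) \<Rightarrow> bool" where
  "decreasing_positive_roots p m e \<longleftrightarrow>
     (\<forall>j. 1 \<le> j \<and> j < m \<longrightarrow> e j > e (j + 1)) \<and> (\<forall>j\<in>{1..m}. e j > 0) \<and>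
     p = (\<Prod>j\<in>{1..m}. [:- e j, 1:])"

lemma decreasing_less:
  fixes e :: "nat \<Rightarrow> real"
  assumes dec: "\<And>j. 1 \<le> j \<Longrightarrow> j < m \<Longrightarrow> e j > e (j + 1)"
    and ij: "1 \<le> i" "i < j" "j \<le> m"
  shows "e i > e j"
proof -
  from ij(2) have "Suc i \<le> j" by simp
  then show ?thesis using ij(3)
  proof (induction j rule: dec_induct)
    case base
    then show ?case using dec[of i] ij(1) by simp
  next
    case (step k)
    then show ?case using dec[of k] ij(1) by simp
  qed
qed

text \<open>If the lists agree before \<open>j\<close>, then \<open>e' j\<close> occurs in
  \<open>e\<close> only at a position from \<open>j\<close> on, so \<open>e' j \<le> e j\<close>;
  symmetry gives equality.\<close>

lemma decreasing_unique:
  fixes e e' :: "nat \<Rightarrow> real"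
  assumes dec: "\<And>j. 1 \<le> j \<Longrightarrow> j < m \<Longrightarrow> e j > e (j + 1)"
    and dec': "\<And>j. 1 \<le> j \<Longrightarrow> j < m \<Longrightarrow> e' j > e' (j + 1)"
    and img: "e ` {1..m} = e' ` {1..m}" and j: "j \<in> {1..m}"
  shows "e j = e' j"
  using j
proof (induction j rule: less_induct)
  case (less j)
  have le: "c' j \<le> c j"
    if c: "\<And>i k. 1 \<le> i \<Longrightarrow> i < k \<Longrightarrow> k \<le> m \<Longrightarrow> c i > c k"
      "\<And>i k. 1 \<le> i \<Longrightarrow> i < k \<Longrightarrow> k \<le> m \<Longrightarrow> c' i > c' k"
      "c ` {1..m} = c' ` {1..m}" "\<And>i. i < j \<Longrightarrow> i \<in> {1..m} \<Longrightarrow> c i = c' i"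
    for c c' :: "nat \<Rightarrow> real"
  proof -
    obtain k where k: "k \<in> {1..m}" "c' j = c k" using c(3) less.prems by blast
    have "\<not> k < j" using c(2)[of k j] c(4)[of k] k less.prems by force
    then show ?thesis using c(1)[of j k] k less.prems by (cases "k = j") auto
  qed
  note d = decreasing_less[of m e, OF dec] and d' = decreasing_less[of m e', OF dec']
  show ?case
  proof (rule order_antisym)
    show "e j \<le> e' j" by (rule le[OF d' d img[symmetric]]) (use less.IH in simp_all)
    show "e' j \<le> e j" by (rule le[OF d d' img]) (use less.IH in simp_all)
  qed
qed

lemma decreasing_positive_roots_iff:
  assumes "decreasing_positive_roots p m e"
  shows "poly p x = 0 \<longleftrightarrow> x \<in> e ` {1..m}"
  using assms by (auto simp: decreasing_positive_roots_def poly_prod)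

lemma decreasing_positive_roots_unique:
  assumes e: "decreasing_positive_roots p m e" and e': "decreasing_positive_roots p m e'"
    and j: "j \<in> {1..m}"
  shows "e j = e' j"
proof (rule decreasing_unique[OF _ _ _ j])
  show "e ` {1..m} = e' ` {1..m}"
    using decreasing_positive_roots_iff[OF e] decreasing_positive_roots_iff[OF e'] by blast
qed (use e e' in \<open>auto simp: decreasing_positive_roots_def\<close>)

lemma monic_eq_prod_roots:
  fixes f :: "'a :: idom poly"
  assumes "degree f = card S" "lead_coeff f = 1" "finite S" "\<And>x. x \<in> S \<Longrightarrow> poly f x = 0"
  shows "f = (\<Prod>x\<in>S. [:- x, 1:])"
proof (rule poly_eqI_degree_lead_coeff[where A = S and n = "card S"])
  let ?g = "\<Prod>x\<in>S. [:- x, 1:]"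
  have deg: "degree ?g = card S" by (simp add: degree_prod_eq_sum_degree)
  have "lead_coeff ?g = 1" by (simp add: lead_coeff_prod)
  then show "coeff f (card S) = coeff ?g (card S)" using deg assms by simp
  show "degree ?g \<le> card S" by (simp add: deg)
qed (use assms in \<open>auto simp: poly_prod\<close>)

text \<open>In the application \<open>mu\<close> lists the roots after one end index is deleted and
  \<open>nu\<close> those after both are; the product in \<open>fh\<close> is then the value of the
  latter polynomial.\<close>

lemma interlacing_roots:
  fixes f :: "real poly"
  assumes f: "degree f = Suc m" "coeff f (Suc m) = 1" "(-1) ^ Suc m * poly f 0 > 0"
    and mu_pos: "\<And>j. j \<in> {1..m} \<Longrightarrow> mu j > 0"
    and nu: "\<And>j. 1 \<le> j \<Longrightarrow> j < m \<Longrightarrow> mu j > nu j \<and> nu j > mu (j + 1)"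
    and fh: "\<And>j. j \<in> {1..m} \<Longrightarrow> poly f (mu j) * (\<Prod>i\<in>{1..<m}. mu j - nu i) < 0"
  shows "\<exists>lam. decreasing_positive_roots f (Suc m) lam \<and>
    (\<forall>j\<in>{1..m}. lam j > mu j \<and> mu j > lam (j + 1))"
proof -
  have mu_less: "mu i > mu j" if "1 \<le> i" "i < j" "j \<le> m" for i j
    using decreasing_less[of m mu i j] nu that by force
  \<comment> \<open>Exactly the \<open>j - 1\<close> factors with \<open>i < j\<close> are negative,
    so \<open>fh\<close> gives \<open>f\<close> the sign \<open>(-1) ^ j\<close> at
    \<open>mu j\<close>.\<close>
  have f_mu: "(-1) ^ j * poly f (mu j) > 0" if j: "j \<in> {1..m}" for j
  proof -
    have split: "{1..<m} = {1..<j} \<union> {j..<m}" using j by auto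
    have neg: "mu j - nu i < 0" if "i \<in> {1..<j}" for i
      using nu[of i] mu_less[of "i + 1" j] that j by (cases "i + 1 = j") auto
    have pos: "mu j - nu i > 0" if "i \<in> {j..<m}" for i
      using nu[of i] mu_less[of j i] that j by (cases "i = j") auto
    have "(\<Prod>i\<in>{1..<m}. mu j - nu i) = (\<Prod>i\<in>{1..<j}. mu j - nu i) * (\<Prod>i\<in>{j..<m}. mu j - nu i)"
      unfolding split by (rule prod.union_disjoint) auto
    also have "(\<Prod>i\<in>{1..<j}. mu j - nu i) = (-1) ^ (j - 1) * (\<Prod>i\<in>{1..<j}. - (mu j - nu i))"
    proof -
      have "(\<Prod>i\<in>{1..<j}. mu j - nu i) = (\<Prod>i\<in>{1..<j}. (-1) * (- (mu j - nu i)))" by simp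
      then show ?thesis by (simp only: prod.distrib prod_constant card_atLeastLessThan)
    qed
    finally have "(\<Prod>i\<in>{1..<m}. mu j - nu i) =
      (-1) ^ (j - 1) * ((\<Prod>i\<in>{1..<j}. - (mu j - nu i)) * (\<Prod>i\<in>{j..<m}. mu j - nu i))"
      (is "_ = _ * ?P") by (simp add: mult.assoc)
    moreover have "?P > 0"
      using neg pos by (intro mult_pos_pos prod_pos) auto
    moreover have "(-1 :: real) ^ j = - ((-1) ^ (j - 1))" using j by (cases j) auto
    ultimately show ?thesis using fh[OF j]
      by (auto simp: mult_less_0_iff zero_less_mult_iff uminus_power_if split: if_splits)
  qed
  have "lead_coeff f = 1" using f by simp
  then obtain R where R1: "\<And>x. x \<ge> R \<Longrightarrow> poly f x \<ge> 1"
    using poly_pinfty_gt_lc[of f] by auto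
  have R: "poly f x > 0" if "x \<ge> R" for x
    using R1[OF that] by linarith
  \<comment> \<open>\<open>mu\<close> is extended by the endpoints \<open>0\<close> on the left and
    a point on the right where \<open>f\<close> is positive. The inner \<open>max\<close> with
    \<open>0\<close> keeps \<open>y 0\<close> positive when \<open>m = 0\<close> and
    \<open>mu 1\<close> is arbitrary.\<close>
  define y where "y j = (if j = 0 then max R (max 0 (mu 1) + 1) else if j = Suc m then 0 else mu j)" for j
  have f_y: "(-1) ^ j * poly f (y j) > 0" if j: "j \<le> Suc m" for j
  proof -
    consider "j = 0" | "j \<in> {1..m}" | "j = Suc m" using j by fastforce
    then show ?thesis
      using f(3) f_mu[of j] R[of "y 0"] by cases (simp_all add: y_def)
  qed
  have y_dec: "y j > y (Suc j)" if "j \<le> m" for j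
    using that mu_pos[of j] mu_less[of j "Suc j"] by (auto simp: y_def)
  have "\<exists>x>y (Suc j). x < y j \<and> poly f x = 0" if "j \<le> m" for j
  proof (rule poly_IVT[OF y_dec[OF that]])
    show "poly f (y (Suc j)) * poly f (y j) < 0"
      using f_y[of j] f_y[of "Suc j"] that
      by (auto simp: mult_less_0_iff zero_less_mult_iff uminus_power_if split: if_splits)
  qed
  then obtain z where z: "\<And>j. j \<le> m \<Longrightarrow> y (Suc j) < z j \<and> z j < y j \<and> poly f (z j) = 0"
    by metis
  \<comment> \<open>The zeros \<open>z\<close> are numbered from \<open>0\<close>, the eigenvalues
    from \<open>1\<close>.\<close>
  define lam where "lam j = z (j - 1)" for j
  have lam: "y j < lam j" "lam j < y (j - 1)" "poly f (lam j) = 0" if "j \<in> {1..Suc m}" for j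
    using z[of "j - 1"] that by (auto simp: lam_def)
  have dec: "lam j > lam (j + 1)" if "1 \<le> j" "j < Suc m" for j
    using lam[of j] lam[of "j + 1"] that by auto
  have inj: "inj_on lam {1..Suc m}"
    using decreasing_less[of "Suc m" lam, OF dec]
    by (intro linorder_inj_onI') (metis atLeastAtMost_iff order_less_irrefl)
  have y_nonneg: "y j \<ge> 0" if "j \<in> {1..Suc m}" for j
    using that mu_pos[of j] by (auto simp: y_def)
  have card: "card (lam ` {1..Suc m}) = Suc m" using card_image[OF inj] by simp
  have "f = (\<Prod>x\<in>lam ` {1..Suc m}. [:- x, 1:])"
  proof (rule monic_eq_prod_roots)
    show "degree f = card (lam ` {1..Suc m})" using f(1) card by simp
    show "lead_coeff f = 1" using f by simp
    show "poly f x = 0" if "x \<in> lam ` {1..Suc m}" for x using that lam(3) by blast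
  qed simp
  also have "\<dots> = (\<Prod>j\<in>{1..Suc m}. [:- lam j, 1:])"
    by (simp only: prod.reindex[OF inj] o_def)
  finally have "decreasing_positive_roots f (Suc m) lam"
    unfolding decreasing_positive_roots_def
    using dec le_less_trans[OF y_nonneg lam(1)] by blast
  moreover have "lam j > mu j \<and> mu j > lam (j + 1)" if "j \<in> {1..m}" for j
    using lam(1)[of j] lam(2)[of "j + 1"] that by (auto simp: y_def)
  ultimately show ?thesis by blast
qed


section \<open>Induction on the size of the matrix\<close>

text \<open>Both ends are treated together because the step for one end uses the induction
  hypothesis for the other.\<close>

lemma SK_matrix_eigenvalues_interlace:
  assumes "SK_matrix A" "A \<in> carrier_mat n n"
  shows "\<exists>lam. decreasing_positive_roots (char_poly A) n lam \<and>
    (1 \<le> n \<longrightarrow> (\<forall>r\<in>{0, n - 1}. \<exists>mu.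
      decreasing_positive_roots (char_poly (mat_delete A r r)) (n - 1) mu \<and>
      (\<forall>j\<in>{1..n - 1}. lam j > mu j \<and> mu j > lam (j + 1))))"
  using assms
proof (induction n arbitrary: A)
  case 0
  then have "char_poly A = 1"
    using degree_monic_char_poly[of A 0] by (auto elim: degree_eq_zeroE)
  then show ?case by (auto simp: decreasing_positive_roots_def)
next
  case (Suc m)
  note SK = Suc.prems(1) and A = Suc.prems(2)
  let ?f = "char_poly A"
  have "\<exists>lam mu. decreasing_positive_roots ?f (Suc m) lam \<and>
      decreasing_positive_roots (char_poly (mat_delete A r r)) m mu \<and>
      (\<forall>j\<in>{1..m}. lam j > mu j \<and> mu j > lam (j + 1))" if r: "r \<in> {0, m}" for r
  proof -
    let ?B = "mat_delete A r r"
    have B: "?B \<in> carrier_mat m m" using mat_delete_carrier[OF A] by simp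
    have SKB: "SK_matrix ?B" using SK_matrix_delete[OF SK A] r by auto
    obtain mu where mu: "decreasing_positive_roots (char_poly ?B) m mu"
      and nu: "\<And>r'. 1 \<le> m \<Longrightarrow> r' \<in> {0, m - 1} \<Longrightarrow> \<exists>nu.
        decreasing_positive_roots (char_poly (mat_delete ?B r' r')) (m - 1) nu \<and>
        (\<forall>j\<in>{1..m - 1}. mu j > nu j \<and> nu j > mu (j + 1))"
      using Suc.IH[OF SKB B] by blast
    have mu_pos: "\<And>j. j \<in> {1..m} \<Longrightarrow> mu j > 0"
      using mu by (simp add: decreasing_positive_roots_def)
    have "\<exists>nu. (\<forall>j. 1 \<le> j \<longrightarrow> j < m \<longrightarrow> mu j > nu j \<and> nu j > mu (j + 1)) \<and>
      (\<forall>j\<in>{1..m}. poly ?f (mu j) * (\<Prod>i\<in>{1..<m}. mu j - nu i) < 0)"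
    proof (cases "m = 0")
      case False
      \<comment> \<open>The end opposite to \<open>r\<close>, in the numbering of \<open>?B\<close>;
        for either \<open>r\<close> the two deletions leave the same central submatrix.\<close>
      define r' where "r' = (if r = 0 then m - 1 else 0)"
      have "r' \<in> {0, m - 1}" by (auto simp: r'_def)
      then obtain nu where nu1: "decreasing_positive_roots (char_poly (mat_delete ?B r' r')) (m - 1) nu"
        and nu2: "\<And>j. j \<in> {1..m - 1} \<Longrightarrow> mu j > nu j \<and> nu j > mu (j + 1)"
        using nu[of r'] False by auto
      have H: "mat_delete ?B r' r' = mat_delete (mat_delete A m m) 0 0"
        using A r False by (intro eq_matI) (auto simp: mat_delete_def r'_def)
      have "poly ?f (mu j) * (\<Prod>i\<in>{1..<m}. mu j - nu i) < 0" if j: "j \<in> {1..m}" for j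
      proof -
        have "{1..m - 1} = {1..<m}" by auto
        then have "poly (char_poly (mat_delete ?B r' r')) (mu j) = (\<Prod>i\<in>{1..<m}. mu j - nu i)"
          using nu1 by (simp add: decreasing_positive_roots_def poly_prod)
        moreover have "poly (char_poly ?B) (mu j) = 0"
          using decreasing_positive_roots_iff[OF mu] j by blast
        \<comment> \<open>One of the two factors is the characteristic polynomial of
          \<open>?B\<close>, which vanishes at \<open>mu j\<close>.\<close>
        then have zero: "poly (char_poly (mat_delete A 0 0)) (mu j) * poly (char_poly (mat_delete A m m)) (mu j) = 0"
          using r by auto
        moreover have "poly ?f (mu j) * poly (char_poly (mat_delete ?B r' r')) (mu j) < 0"
          using SK_matrix_char_poly_less[OF SK A, of "mu j"] False mu_pos[OF j]
          unfolding H zero by simp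
        ultimately show ?thesis by simp
      qed
      then show ?thesis using nu2 by (intro exI[of _ nu]) auto
    qed auto
    then obtain nu where "\<And>j. 1 \<le> j \<Longrightarrow> j < m \<Longrightarrow> mu j > nu j \<and> nu j > mu (j + 1)"
      "\<And>j. j \<in> {1..m} \<Longrightarrow> poly ?f (mu j) * (\<Prod>i\<in>{1..<m}. mu j - nu i) < 0"
      by blast
    then have "\<exists>lam. decreasing_positive_roots ?f (Suc m) lam \<and>
        (\<forall>j\<in>{1..m}. lam j > mu j \<and> mu j > lam (j + 1))"
      using degree_monic_char_poly[OF A] SK_matrix_char_poly_0[OF SK A] mu_pos
      by (intro interlacing_roots) auto
    then show ?thesis using mu by blast
  qed
  note step = this
  obtain lam where lam: "decreasing_positive_roots ?f (Suc m) lam" using step[of 0] by blast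
  have "\<exists>mu. decreasing_positive_roots (char_poly (mat_delete A r r)) m mu \<and>
      (\<forall>j\<in>{1..m}. lam j > mu j \<and> mu j > lam (j + 1))" if r: "r \<in> {0, m}" for r
  proof -
    \<comment> \<open>The list from \<open>step\<close> may depend on \<open>r\<close>; uniqueness
      identifies it with the \<open>lam\<close> chosen for \<open>r = 0\<close>.\<close>
    obtain lam' mu where lam': "decreasing_positive_roots ?f (Suc m) lam'"
      and mu: "decreasing_positive_roots (char_poly (mat_delete A r r)) m mu"
      and less: "\<And>j. j \<in> {1..m} \<Longrightarrow> lam' j > mu j \<and> mu j > lam' (j + 1)"
      using step[OF r] by blast
    have "lam j = lam' j" if "j \<in> {1..Suc m}" for j
      using decreasing_positive_roots_unique[OF lam lam' that] .
    then show ?thesis using mu less by (intro exI[of _ mu]) auto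
  qed
  then show ?case using lam by auto
qed

section \<open>From root lists to eigenvalues and the spectral radius\<close>

lemma decreasing_positive_roots_spectrum:
  assumes A: "A \<in> carrier_mat n n" and e: "decreasing_positive_roots (char_poly A) n e"
  shows "spectrum (map_mat complex_of_real A) = (\<lambda>j. complex_of_real (e j)) ` {1..n}"
proof -
  interpret map_poly_hom: map_poly_comm_ring_hom complex_of_real ..
  have "char_poly (map_mat complex_of_real A) = map_poly complex_of_real (char_poly A)"
    by (rule of_real_hom.char_poly_hom[OF A])
  also have "\<dots> = (\<Prod>j\<in>{1..n}. [:- complex_of_real (e j), 1:])"
    using e by (simp add: decreasing_positive_roots_def map_poly_hom.hom_prod)
  finally show ?thesis
    using A by (subst spectrum_root_char_poly[of _ n]) (auto simp: poly_prod)
qed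

lemma decreasing_positive_roots_eigenvalues:
  assumes A: "A \<in> carrier_mat n n" and e: "decreasing_positive_roots (char_poly A) n e"
  shows "decreasing_positive_eigenvalues A n e"
  using e decreasing_positive_roots_spectrum[OF A e]
  by (simp add: decreasing_positive_eigenvalues_def decreasing_positive_roots_def)

text \<open>Carries the interlacing from one list \<open>mu\<close> over to every such list.\<close>

lemma decreasing_positive_eigenvalues_unique:
  assumes e: "decreasing_positive_eigenvalues A n e" and e': "decreasing_positive_eigenvalues A n e'"
    and j: "j \<in> {1..n}"
  shows "e j = e' j"
proof (rule decreasing_unique[OF _ _ _ j])
  have "complex_of_real ` e ` {1..n} = complex_of_real ` e' ` {1..n}"
    using e e' by (simp add: decreasing_positive_eigenvalues_def image_image)
  then show "e ` {1..n} = e' ` {1..n}"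
    by (simp add: inj_image_eq_iff inj_of_real)
qed (use e e' in \<open>auto simp: decreasing_positive_eigenvalues_def\<close>)

lemma decreasing_positive_roots_order:
  assumes e: "decreasing_positive_roots p m e" and j: "j \<in> {1..m}"
  shows "Polynomial.order (e j) p = 1"
proof -
  let ?q = "\<Prod>i\<in>{1..m} - {j}. [:- e i, 1:]"
  have "e i \<noteq> e j" if "i \<in> {1..m} - {j}" for i
    using decreasing_less[of m e i j] decreasing_less[of m e j i] e that j
    by (cases i j rule: linorder_cases) (auto simp: decreasing_positive_roots_def)
  then have q: "poly ?q (e j) \<noteq> 0" by (fastforce simp: poly_prod)
  have p: "p = [:- e j, 1:] * ?q"
    using e j by (simp add: decreasing_positive_roots_def prod.remove)
  have "[:- e j, 1:] * ?q \<noteq> 0" by (rule no_zero_divisors) (use q in auto)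
  then have "Polynomial.order (e j) p = Polynomial.order (e j) [:- e j, 1:] + Polynomial.order (e j) ?q"
    unfolding p by (rule order_mult)
  also have "Polynomial.order (e j) ?q = 0" using q by (rule order_0I)
  also have "Polynomial.order (e j) [:- e j, 1:] = 1" using order_power_n_n[of "e j" 1] by simp
  finally show ?thesis by simp
qed

text \<open>Positive eigenvalues equal their moduli, so the first in the list is the
  maximum.\<close>

lemma decreasing_positive_roots_spectral_radius:
  assumes A: "A \<in> carrier_mat n n" and e: "decreasing_positive_roots (char_poly A) n e"
    and n: "1 \<le> n"
  shows "spectral_radius (map_mat complex_of_real A) = e 1"
  unfolding spectral_radius_def
proof (rule Max_eqI)
  have sp: "norm ` spectrum (map_mat complex_of_real A) = e ` {1..n}"
    using e unfolding decreasing_positive_roots_spectrum[OF A e] image_image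
    by (intro image_cong) (auto simp: decreasing_positive_roots_def less_imp_le)
  show "finite (norm ` spectrum (map_mat complex_of_real A))"
    and "e 1 \<in> norm ` spectrum (map_mat complex_of_real A)"
    using n by (auto simp: sp)
  fix x assume "x \<in> norm ` spectrum (map_mat complex_of_real A)"
  then obtain j where j: "j \<in> {1..n}" "x = e j" by (auto simp: sp)
  then show "x \<le> e 1"
    using decreasing_less[of n e 1 j] e
    by (cases "j = 1") (auto simp: decreasing_positive_roots_def)
qed

theorem theorem10:
  fixes A :: "real mat" and n :: nat
  assumes "n \<ge> 1"
    and "A \<in> carrier_mat n n"
    and "SK_matrix A"
  shows "\<exists>lam :: nat \<Rightarrow> real.
    decreasing_positive_eigenvalues A n lam \<and>
    (\<forall>j\<in>{1..n}. Polynomial.order (lam j) (char_poly A) = 1) \<and>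
    spectral_radius (map_mat complex_of_real A) = lam 1 \<and>
    (\<forall>r\<in>{1, n}.
      (\<exists>mu. decreasing_positive_eigenvalues (mat_delete A (r - 1) (r - 1)) (n - 1) mu) \<and>
      (\<forall>mu. decreasing_positive_eigenvalues (mat_delete A (r - 1) (r - 1)) (n - 1) mu \<longrightarrow>
         (\<forall>j\<in>{1..n - 1}. lam j > mu j \<and> mu j > lam (j + 1))))"
proof -
  note n = assms(1) and A = assms(2)
  obtain lam where lam: "decreasing_positive_roots (char_poly A) n lam"
    and interlace: "\<And>r. r \<in> {0, n - 1} \<Longrightarrow> \<exists>mu.
      decreasing_positive_roots (char_poly (mat_delete A r r)) (n - 1) mu \<and>
      (\<forall>j\<in>{1..n - 1}. lam j > mu j \<and> mu j > lam (j + 1))"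
    using SK_matrix_eigenvalues_interlace[OF assms(3) A] n by blast
  show ?thesis
  proof (rule exI[of _ lam], intro conjI ballI allI impI)
    show "decreasing_positive_eigenvalues A n lam"
      by (rule decreasing_positive_roots_eigenvalues[OF A lam])
    show "Polynomial.order (lam j) (char_poly A) = 1" if "j \<in> {1..n}" for j
      by (rule decreasing_positive_roots_order[OF lam that])
    show "spectral_radius (map_mat complex_of_real A) = lam 1"
      by (rule decreasing_positive_roots_spectral_radius[OF A lam n])
  next
    \<comment> \<open>Row \<open>r\<close> of the statement, counted from \<open>1\<close>, has
      index \<open>r - 1\<close> in the matrix.\<close>
    fix r assume "r \<in> {1, n}"
    then have "r - 1 \<in> {0, n - 1}" by auto
    then obtain mu0 where mu0: "decreasing_positive_eigenvalues (mat_delete A (r - 1) (r - 1)) (n - 1) mu0"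
      and less: "\<And>j. j \<in> {1..n - 1} \<Longrightarrow> lam j > mu0 j \<and> mu0 j > lam (j + 1)"
      using interlace[of "r - 1"] decreasing_positive_roots_eigenvalues[OF mat_delete_carrier[OF A]]
      by blast
    then show "\<exists>mu. decreasing_positive_eigenvalues (mat_delete A (r - 1) (r - 1)) (n - 1) mu" by blast
    fix mu j
    assume "decreasing_positive_eigenvalues (mat_delete A (r - 1) (r - 1)) (n - 1) mu" "j \<in> {1..n - 1}"
    then show "lam j > mu j" "mu j > lam (j + 1)"
      using less[of j] decreasing_positive_eigenvalues_unique[OF _ mu0, of mu j] by simp_all
  qed
qed

end
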